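(* Let $X$ be an implicative involutive BE algebra. The following are equivalent: (a) $X$ is an implicative-orthomodular lattice; (b) for all $x,y\in X$, $x\le_L y$ implies $x\le_Q y$; (c) for all $x,y\in X$, $x\le_L y$ implies $y=y\Cup x$.
   Context: A BE algebra is an algebra $(X,\to,1)$ of type $(2,0)$ such that for all $x,y,z\in X$: $x\to x=1$; $x\to 1=1$; $1\to x=x$; $x\to(y\to z)=y\to(x\to z)$. Write $x\le y$ iff $x\to y=1$. It is bounded if there is $0\in X$ with $0\le x$ for all $x\in X$; then $x^*:=x\to 0$. A bounded BE algebra is involutive if $x^{**}=x$ for all $x$. A BE algebra is implicative if $(x\to y)\to x=x$ for all $x,y$. In an involutive BE algebra put $x\Cup y:=(x\to y)\to y$ and $x\Cap y:=((x^*\to y^* )\to y^* )^*$; define $x\le_Q y$ iff $x=x\Cap y$, and $x\le_L y$ iff $x=(x\to y^* )^*$. An implicative-orthomodular lattice is an implicative involutive BE algebra satisfying $x\Cap(y\to x)=x$ for all $x,y$. *)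

theory Defs
  imports Main
begin

text \<open>An algebra is modelled by its operations on a type; the carrier is the whole type.\<close>

locale be_algebra =
  fixes imp :: "'a \<Rightarrow> 'a \<Rightarrow> 'a"  (infixr "\<rightarrow>" 70)
    and one :: 'a  ("\<one>")
  assumes imp_self: "x \<rightarrow> x = \<one>"
    and imp_one: "x \<rightarrow> \<one> = \<one>"
    and one_imp: "\<one> \<rightarrow> x = x"
    and exchange: "x \<rightarrow> (y \<rightarrow> z) = y \<rightarrow> (x \<rightarrow> z)"
begin

definition le :: "'a \<Rightarrow> 'a \<Rightarrow> bool"  (infix "\<preceq>" 50)
  where "x \<preceq> y \<longleftrightarrow> x \<rightarrow> y = \<one>"

end

text \<open>
  The relation \<open>\<preceq>\<close> need not be antisymmetric, so the lower bound is carried as part of the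
  structure. In the involutive case it is unique: if \<open>0'\<close> is another lower bound, then
  \<open>0' \<rightarrow> 0 = 1\<close>, whence \<open>0' = (0' \<rightarrow> 0) \<rightarrow> 0 = 1 \<rightarrow> 0 = 0\<close>.
\<close>

locale bounded_be_algebra = be_algebra +
  fixes zero :: 'a  ("\<zero>")
  assumes zero_le: "\<zero> \<preceq> x"
begin

definition neg :: "'a \<Rightarrow> 'a"  ("_\<^sup>\<star>" [1000] 1000)
  where "x\<^sup>\<star> = x \<rightarrow> \<zero>"

end

locale involutive_be_algebra = bounded_be_algebra +
  assumes involutive: "x\<^sup>\<star>\<^sup>\<star> = x"
begin

definition join :: "'a \<Rightarrow> 'a \<Rightarrow> 'a"  (infixl "\<Cup>" 65)
  where "x \<Cup> y = (x \<rightarrow> y) \<rightarrow> y"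

definition meet :: "'a \<Rightarrow> 'a \<Rightarrow> 'a"  (infixl "\<Cap>" 65)
  where "x \<Cap> y = ((x\<^sup>\<star> \<rightarrow> y\<^sup>\<star>) \<rightarrow> y\<^sup>\<star>)\<^sup>\<star>"

definition le_Q :: "'a \<Rightarrow> 'a \<Rightarrow> bool"  (infix "\<le>\<^sub>Q" 50)
  where "x \<le>\<^sub>Q y \<longleftrightarrow> x = x \<Cap> y"

definition le_L :: "'a \<Rightarrow> 'a \<Rightarrow> bool"  (infix "\<le>\<^sub>L" 50)
  where "x \<le>\<^sub>L y \<longleftrightarrow> x = (x \<rightarrow> y\<^sup>\<star>)\<^sup>\<star>"

end

locale implicative_be_algebra = be_algebra +
  assumes implicative: "(x \<rightarrow> y) \<rightarrow> x = x"

locale implicative_involutive_be_algebra = involutive_be_algebra + implicative_be_algebra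

locale implicative_orthomodular_lattice = implicative_involutive_be_algebra +
  assumes orthomodular: "x \<Cap> (y \<rightarrow> x) = x"

end

theory Submission
  imports Defs
begin

text \<open>
  Negation reverses \<open>\<le>\<^sub>L\<close>, and it turns \<open>x \<le>\<^sub>Q y\<close> into the equation \<open>x\<^sup>\<star> = x\<^sup>\<star> \<Cup> y\<^sup>\<star>\<close>, so the
  conditions on \<open>\<le>\<^sub>Q\<close> and on \<open>\<Cup>\<close> are dual. The orthomodular law says \<open>x \<le>\<^sub>Q y \<rightarrow> x\<close>, and the
  elements \<open>y \<rightarrow> x\<close> are exactly the \<open>\<le>\<^sub>L\<close>-upper bounds of \<open>x\<close>: if \<open>x \<le>\<^sub>L y\<close> then \<open>y = y\<^sup>\<star> \<rightarrow> x\<close>.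
\<close>

context involutive_be_algebra
begin

lemma imp_neg_commute: "x \<rightarrow> y\<^sup>\<star> = y \<rightarrow> x\<^sup>\<star>"
  unfolding neg_def by (rule exchange)

lemma neg_imp_neg: "x\<^sup>\<star> \<rightarrow> y\<^sup>\<star> = y \<rightarrow> x"
  using imp_neg_commute [of "x\<^sup>\<star>" y] by (simp add: involutive)

lemma neg_imp_commute: "x\<^sup>\<star> \<rightarrow> y = y\<^sup>\<star> \<rightarrow> x"
  using neg_imp_neg [of x "y\<^sup>\<star>"] by (simp add: involutive)

lemma neg_eq_iff: "x\<^sup>\<star> = y\<^sup>\<star> \<longleftrightarrow> x = y"
  by (metis involutive)

lemma le_Q_neg_iff: "y\<^sup>\<star> \<le>\<^sub>Q x\<^sup>\<star> \<longleftrightarrow> y = y \<Cup> x"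
  by (simp add: le_Q_def meet_def join_def involutive neg_eq_iff)

end

context implicative_involutive_be_algebra
begin

text \<open>Contraposition turns the defining equation of \<open>\<le>\<^sub>L\<close> into the
  implicative law for \<open>x\<^sup>\<star>\<close> and \<open>y\<^sup>\<star>\<close>.\<close>

lemma le_L_imp_right: "x \<le>\<^sub>L y \<rightarrow> x"
proof -
  have "x \<rightarrow> (y \<rightarrow> x)\<^sup>\<star> = (x\<^sup>\<star> \<rightarrow> y\<^sup>\<star>) \<rightarrow> x\<^sup>\<star>"
    by (simp add: imp_neg_commute [of x] neg_imp_neg)
  then show ?thesis
    by (simp add: le_L_def implicative involutive)
qed

lemma le_L_imp_eq:
  assumes "x \<le>\<^sub>L y"
  shows "y\<^sup>\<star> \<rightarrow> x = y"
proof -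
  have "x\<^sup>\<star> = y \<rightarrow> x\<^sup>\<star>"
    using assms by (metis le_L_def involutive imp_neg_commute)
  \<comment> \<open>The implicative law gives
    \<open>(y \<rightarrow> x\<^sup>\<star>) \<rightarrow> y = y\<close>, and the premise of this
    implication is \<open>x\<^sup>\<star>\<close>.\<close>
  then have "x\<^sup>\<star> \<rightarrow> y = y"
    by (metis implicative)
  then show ?thesis
    by (simp add: neg_imp_commute [of y])
qed

lemma le_L_neg:
  assumes "x \<le>\<^sub>L y"
  shows "y\<^sup>\<star> \<le>\<^sub>L x\<^sup>\<star>"
  using le_L_imp_eq [OF assms] by (simp add: le_L_def involutive)

lemma orthomodular_lattice_iff_le_Q:
  "implicative_orthomodular_lattice (\<rightarrow>) \<one> \<zero> \<longleftrightarrow> (\<forall>x y. x \<le>\<^sub>L y \<longrightarrow> x \<le>\<^sub>Q y)"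
proof
  assume "implicative_orthomodular_lattice (\<rightarrow>) \<one> \<zero>"
  then have "x \<le>\<^sub>Q y \<rightarrow> x" for x y
    by (simp add: le_Q_def implicative_orthomodular_lattice.orthomodular)
  \<comment> \<open>Instantiate with \<open>y\<^sup>\<star>\<close> for \<open>y\<close>: the upper
    bound \<open>y\<^sup>\<star> \<rightarrow> x\<close> is then \<open>y\<close> itself.\<close>
  then show "\<forall>x y. x \<le>\<^sub>L y \<longrightarrow> x \<le>\<^sub>Q y"
    by (metis le_L_imp_eq)
next
  assume "\<forall>x y. x \<le>\<^sub>L y \<longrightarrow> x \<le>\<^sub>Q y"
  then have "x \<Cap> (y \<rightarrow> x) = x" for x y
    using le_L_imp_right [of x y] by (simp add: le_Q_def)
  then show "implicative_orthomodular_lattice (\<rightarrow>) \<one> \<zero>"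
    by unfold_locales
qed

text \<open>In each direction the hypothesis is applied to the reversed pair
  \<open>y\<^sup>\<star>\<close>, \<open>x\<^sup>\<star>\<close>.\<close>

lemma le_Q_iff_join:
  "(\<forall>x y. x \<le>\<^sub>L y \<longrightarrow> x \<le>\<^sub>Q y) \<longleftrightarrow> (\<forall>x y. x \<le>\<^sub>L y \<longrightarrow> y = y \<Cup> x)"
proof
  assume "\<forall>x y. x \<le>\<^sub>L y \<longrightarrow> x \<le>\<^sub>Q y"
  then show "\<forall>x y. x \<le>\<^sub>L y \<longrightarrow> y = y \<Cup> x"
    using le_L_neg le_Q_neg_iff by blast
next
  assume "\<forall>x y. x \<le>\<^sub>L y \<longrightarrow> y = y \<Cup> x"
  then show "\<forall>x y. x \<le>\<^sub>L y \<longrightarrow> x \<le>\<^sub>Q y"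
    using le_L_neg le_Q_neg_iff by (metis involutive)
qed

end

theorem theorem3p13:
  fixes imp :: "'a \<Rightarrow> 'a \<Rightarrow> 'a" and one zero :: 'a
  assumes "implicative_involutive_be_algebra imp one zero"
  shows "(implicative_orthomodular_lattice imp one zero \<longleftrightarrow>
            (\<forall>x y. involutive_be_algebra.le_L imp zero x y \<longrightarrow>
                   involutive_be_algebra.le_Q imp zero x y)) \<and>
         ((\<forall>x y. involutive_be_algebra.le_L imp zero x y \<longrightarrow>
                 involutive_be_algebra.le_Q imp zero x y) \<longleftrightarrow>
            (\<forall>x y. involutive_be_algebra.le_L imp zero x y \<longrightarrow>
                   y = involutive_be_algebra.join imp y x))"
proof -
  interpret implicative_involutive_be_algebra imp one zero
    by (fact assms)
  show ?thesis
    using orthomodular_lattice_iff_le_Q le_Q_iff_join by (rule conjI)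
qed

end
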